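(* Let $X$ be a complex Banach space, let $A$ be a closed linear operator on $X$ with domain $\mathcal{D}(A)$, and let $g\in C^\infty(A)$. Let $\zeta_0\in\rho(A)$, and let $\rho(A,\zeta_0)$ be the connected component of the resolvent set $\rho(A)$ containing $\zeta_0$. If $\mathcal{R}(\zeta_0,A)g\in\overline{\mathcal{K}(A,g)}$ and $A\big(\overline{\mathcal{K}(A,g)}\cap\mathcal{D}(A)\big)\subset\overline{\mathcal{K}(A,g)}$, then $\mathcal{R}(\zeta,A)g\in\overline{\mathcal{K}(A,g)}$ for all $\zeta\in\rho(A,\zeta_0)$.
   Context: $C^\infty(A)=\bigcap_{k\ge 0}\mathcal{D}(A^k)$. For $g\in C^\infty(A)$ the Krylov subspace is $\mathcal{K}(A,g)=\mathrm{span}\{A^kg\mid k\in\mathbb{N}_0\}$, and $\overline{\mathcal{K}(A,g)}$ is its closure in the norm of $X$. $\mathcal{R}(\zeta,A)=(A-\zeta\mathbb{1})^{-1}$ is the resolvent operator for $\zeta\in\rho(A)$. *)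

theory Defs
  imports "HOL-Analysis.Analysis"
begin

class scaleC = scaleR +
  fixes scaleC :: "complex \<Rightarrow> 'a \<Rightarrow> 'a" (infixr "*\<^sub>C" 75)
  assumes scaleR_scaleC: "scaleR r x = scaleC (complex_of_real r) x"

class complex_vector = scaleC + ab_group_add +
  assumes scaleC_add_right: "a *\<^sub>C (x + y) = a *\<^sub>C x + a *\<^sub>C y"
    and scaleC_add_left: "(a + b) *\<^sub>C x = a *\<^sub>C x + b *\<^sub>C x"
    and scaleC_scaleC: "a *\<^sub>C b *\<^sub>C x = (a * b) *\<^sub>C x"
    and scaleC_one: "1 *\<^sub>C x = x"

class complex_normed_vector = complex_vector + real_normed_vector +
  assumes norm_scaleC: "norm (a *\<^sub>C x) = cmod a * norm x"

class complex_banach = complex_normed_vector + banach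

global_interpretation complex_vector:
  vector_space "scaleC :: complex \<Rightarrow> 'a \<Rightarrow> 'a::complex_vector"
  by unfold_locales (rule scaleC_add_right scaleC_add_left scaleC_scaleC scaleC_one)+

instantiation complex :: complex_banach
begin

definition scaleC_complex :: "complex \<Rightarrow> complex \<Rightarrow> complex"
  where "scaleC_complex a x = a * x"

instance
  by standard (simp_all add: scaleC_complex_def scaleR_conv_of_real algebra_simps norm_mult)

end

text \<open>
  An operator on \<open>X\<close> is represented by its domain \<open>D\<close> together with a total function \<open>A\<close>.
  Only the values of \<open>A\<close> on \<open>D\<close> are meaningful; the others are never used, provided
  that \<open>krylov A g\<close> is formed for \<open>g \<in> smooth_vectors D A\<close> only.
\<close>

definition linear_operator :: "'a::complex_vector set \<Rightarrow> ('a \<Rightarrow> 'a) \<Rightarrow> bool"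
  where "linear_operator D A \<longleftrightarrow>
    complex_vector.subspace D \<and>
    (\<forall>x\<in>D. \<forall>y\<in>D. A (x + y) = A x + A y) \<and>
    (\<forall>c. \<forall>x\<in>D. A (c *\<^sub>C x) = c *\<^sub>C A x)"

definition closed_linear_operator :: "'a::complex_normed_vector set \<Rightarrow> ('a \<Rightarrow> 'a) \<Rightarrow> bool"
  where "closed_linear_operator D A \<longleftrightarrow>
    linear_operator D A \<and> closed ((\<lambda>x. (x, A x)) ` D)"

primrec power_domain :: "'a set \<Rightarrow> ('a \<Rightarrow> 'a) \<Rightarrow> nat \<Rightarrow> 'a set"
  where
    "power_domain D A 0 = UNIV"
  | "power_domain D A (Suc k) = {x \<in> D. A x \<in> power_domain D A k}"

definition smooth_vectors :: "'a set \<Rightarrow> ('a \<Rightarrow> 'a) \<Rightarrow> 'a set"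
  where "smooth_vectors D A = (\<Inter>k. power_domain D A k)"

definition krylov :: "('a \<Rightarrow> 'a) \<Rightarrow> 'a \<Rightarrow> 'a::complex_vector set"
  where "krylov A g = complex_vector.span {(A ^^ k) g | k. True}"

definition resolvent :: "'a::complex_vector set \<Rightarrow> ('a \<Rightarrow> 'a) \<Rightarrow> complex \<Rightarrow> 'a \<Rightarrow> 'a"
  where "resolvent D A \<zeta> = inv_into D (\<lambda>x. A x - \<zeta> *\<^sub>C x)"

text \<open>
  In the next definition only the boundedness part of \<^const>\<open>bounded_linear\<close> is a genuine
  requirement: for a linear operator \<open>A\<close> the inverse of a bijective \<open>A - \<zeta>\<close> is automatically
  complex linear.
\<close>

definition resolvent_set :: "'a::complex_normed_vector set \<Rightarrow> ('a \<Rightarrow> 'a) \<Rightarrow> complex set"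
  where "resolvent_set D A =
    {\<zeta>. bij_betw (\<lambda>x. A x - \<zeta> *\<^sub>C x) D UNIV \<and> bounded_linear (resolvent D A \<zeta>)}"

end

theory Submission
  imports Defs
begin

text \<open>
  Write \<open>V\<close> for the closure of the Krylov subspace and \<open>R(\<zeta>)\<close> for the resolvent. The statement
  about the single vector \<open>g\<close> does not propagate well by itself, so it is replaced by a
  statement about \<open>V\<close>: \<open>R(\<zeta>)\<close> maps \<open>V\<close> into itself. At \<open>\<zeta>\<^sub>0\<close> this follows from the hypothesis
  on \<open>g\<close>, because \<open>R(\<zeta>) (A x) = x + \<zeta> R(\<zeta>) x\<close> allows one to climb from \<open>g\<close> to \<open>A\<^sup>k g\<close>
  and then to \<open>V\<close> by linearity
  and boundedness of \<open>R(\<zeta>\<^sub>0)\<close> (\<open>resolvent_maps_krylov_closure\<close>).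

  Invariance of a closed subspace \<open>V\<close> is locally constant in \<open>\<zeta>\<close> on the resolvent set.
  Instead of expanding \<open>R(\<eta>)\<close> in a Neumann series around \<open>\<zeta>\<close>, one notes that \<open>x = R(\<eta>) v\<close> is
  the only solution of the fixed-point equation \<open>x = R(\<zeta>) (v + (\<eta> - \<zeta>) x)\<close>. If
  \<open>\<bar>\<eta> - \<zeta>\<bar> \<parallel>R(\<zeta>)\<parallel> < 1\<close>, then the right-hand side is a contraction of the complete space \<open>V\<close>, so
  the solution lies in \<open>V\<close> (\<open>resolvent_invariance_transfer\<close>). The norm of \<open>R(\<eta>)\<close> stays bounded
  near \<open>\<zeta>\<close>, hence the transfer works in both directions on a small ball
  (\<open>resolvent_invariance_locally_constant\<close>), and connectedness carries invariance from \<open>\<zeta>\<^sub>0\<close> to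
  its whole component.
\<close>

lemma resolvent_right_inverse:
  assumes "\<zeta> \<in> resolvent_set D A"
  shows "resolvent D A \<zeta> y \<in> D"
    and "A (resolvent D A \<zeta> y) - \<zeta> *\<^sub>C resolvent D A \<zeta> y = y"
proof -
  have "y \<in> (\<lambda>x. A x - \<zeta> *\<^sub>C x) ` D"
    using assms by (simp add: resolvent_set_def bij_betw_def)
  from inv_into_into[OF this] f_inv_into_f[OF this]
  show "resolvent D A \<zeta> y \<in> D"
    and "A (resolvent D A \<zeta> y) - \<zeta> *\<^sub>C resolvent D A \<zeta> y = y"
    unfolding resolvent_def .
qed

lemma resolvent_left_inverse:
  assumes "\<zeta> \<in> resolvent_set D A" and "x \<in> D"
  shows "resolvent D A \<zeta> (A x - \<zeta> *\<^sub>C x) = x"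
proof -
  have "inj_on (\<lambda>x. A x - \<zeta> *\<^sub>C x) D"
    using assms(1) by (simp add: resolvent_set_def bij_betw_def)
  from inv_into_f_f[OF this assms(2)] show ?thesis
    by (simp add: resolvent_def)
qed

lemma resolvent_bounded_linear:
  "\<zeta> \<in> resolvent_set D A \<Longrightarrow> bounded_linear (resolvent D A \<zeta>)"
  by (simp add: resolvent_set_def)

lemma resolvent_scaleC:
  assumes "linear_operator D A" and "\<zeta> \<in> resolvent_set D A"
  shows "resolvent D A \<zeta> (c *\<^sub>C y) = c *\<^sub>C resolvent D A \<zeta> y"
proof -
  define x where "x = resolvent D A \<zeta> y"
  have x: "x \<in> D" "A x - \<zeta> *\<^sub>C x = y"
    using resolvent_right_inverse[OF assms(2)] by (auto simp: x_def)
  have cx: "c *\<^sub>C x \<in> D" "A (c *\<^sub>C x) = c *\<^sub>C A x"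
    using assms(1) x(1) unfolding linear_operator_def
    by (blast intro: complex_vector.subspace_scale)+
  have "A (c *\<^sub>C x) - \<zeta> *\<^sub>C (c *\<^sub>C x) = c *\<^sub>C y"
    unfolding cx(2) x(2)[symmetric]
    by (simp add: complex_vector.scale_right_diff_distrib mult.commute)
  with resolvent_left_inverse[OF assms(2) cx(1)] show ?thesis
    by (simp add: x_def)
qed

text \<open>
  This is the first resolvent identity, in the form \<open>R(\<eta>) v = R(\<zeta>) (v + (\<eta> - \<zeta>) R(\<eta>) v)\<close> of a
  fixed-point equation for \<open>R(\<eta>) v\<close>.
\<close>

lemma resolvent_fixed_point:
  assumes "\<zeta> \<in> resolvent_set D A" and "\<eta> \<in> resolvent_set D A"
  shows "resolvent D A \<zeta> (v + (\<eta> - \<zeta>) *\<^sub>C resolvent D A \<eta> v) = resolvent D A \<eta> v"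
proof -
  define x where "x = resolvent D A \<eta> v"
  have x: "x \<in> D" "A x - \<eta> *\<^sub>C x = v"
    using resolvent_right_inverse[OF assms(2)] by (auto simp: x_def)
  have "A x - \<zeta> *\<^sub>C x = v + (\<eta> - \<zeta>) *\<^sub>C x"
    unfolding x(2)[symmetric] by (simp add: complex_vector.scale_left_diff_distrib)
  with resolvent_left_inverse[OF assms(1) x(1)] show ?thesis
    by (simp add: x_def)
qed

lemma bounded_linear_scaleC:
  "bounded_linear (\<lambda>x::'a::complex_normed_vector. c *\<^sub>C x)"
proof (rule bounded_linear_intro)
  fix r and x :: 'a
  show "c *\<^sub>C (r *\<^sub>R x) = r *\<^sub>R (c *\<^sub>C x)"
    by (simp add: scaleR_scaleC mult.commute)
  show "norm (c *\<^sub>C x) \<le> norm x * cmod c"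
    by (simp add: norm_scaleC)
qed (rule scaleC_add_right)

lemma subspace_closure_complex:
  fixes S :: "'a::complex_normed_vector set"
  assumes S: "complex_vector.subspace S"
  shows "complex_vector.subspace (closure S)"
proof (rule complex_vector.subspaceI)
  show "0 \<in> closure S"
    by (rule subsetD[OF closure_subset complex_vector.subspace_0[OF S]])
  show "x + y \<in> closure S" if x: "x \<in> closure S" and y: "y \<in> closure S" for x y
  proof -
    obtain u where u: "\<forall>n. u n \<in> S" "u \<longlonglongrightarrow> x"
      using iffD1[OF closure_sequential x] by (elim exE conjE)
    obtain w where w: "\<forall>n. w n \<in> S" "w \<longlonglongrightarrow> y"
      using iffD1[OF closure_sequential y] by (elim exE conjE)
    have "\<forall>n. u n + w n \<in> S"
      using u(1) w(1) by (simp add: complex_vector.subspace_add[OF S])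
    moreover have "(\<lambda>n. u n + w n) \<longlonglongrightarrow> x + y"
      by (rule tendsto_add[OF u(2) w(2)])
    ultimately show ?thesis
      by (intro iffD2[OF closure_sequential] exI conjI)
  qed
  show "c *\<^sub>C x \<in> closure S" if x: "x \<in> closure S" for c x
  proof -
    have "(\<lambda>x. c *\<^sub>C x) ` S \<subseteq> closure S"
      by (intro image_subsetI subsetD[OF closure_subset] complex_vector.subspace_scale[OF S])
    then have "(\<lambda>x. c *\<^sub>C x) ` closure S \<subseteq> closure S"
      by (intro image_closure_subset closed_closure
          bounded_linear.continuous_on[OF bounded_linear_scaleC continuous_on_id])
    then show ?thesis
      using x by (simp add: image_subset_iff)
  qed
qed

lemma funpow_in_power_domain:
  assumes "x \<in> power_domain D A (k + m)"
  shows "(A ^^ k) x \<in> power_domain D A m"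
  using assms
proof (induction k arbitrary: x)
  case (Suc k)
  then have "(A ^^ k) (A x) \<in> power_domain D A m" by simp
  then show ?case by (simp add: funpow_swap1)
qed simp

lemma funpow_smooth_vector_in_domain:
  assumes "g \<in> smooth_vectors D A"
  shows "(A ^^ k) g \<in> D"
proof -
  have "g \<in> power_domain D A (k + 1)"
    using assms unfolding smooth_vectors_def by blast
  from funpow_in_power_domain[OF this] show ?thesis by simp
qed

text \<open>
  The vectors whose image under \<open>R(\<zeta>)\<close> lies in \<open>V\<close> form a closed subspace. It contains \<open>g\<close> by
  assumption, and with a vector \<open>A\<^sup>k g\<close> also \<open>A\<^sup>k\<^sup>+\<^sup>1 g\<close>, since
  \<open>R(\<zeta>) A\<^sup>k\<^sup>+\<^sup>1 g = A\<^sup>k g + \<zeta> R(\<zeta>) A\<^sup>k g\<close>.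
\<close>

lemma resolvent_maps_krylov_closure:
  fixes D :: "'a::complex_normed_vector set"
  assumes lin: "linear_operator D A" and g: "g \<in> smooth_vectors D A"
    and \<zeta>: "\<zeta> \<in> resolvent_set D A"
    and Rg: "resolvent D A \<zeta> g \<in> closure (krylov A g)"
  shows "resolvent D A \<zeta> ` closure (krylov A g) \<subseteq> closure (krylov A g)"
proof -
  let ?R = "resolvent D A \<zeta>" and ?V = "closure (krylov A g)"
  interpret R: bounded_linear ?R
    by (rule resolvent_bounded_linear[OF \<zeta>])
  have V: "complex_vector.subspace ?V"
    unfolding krylov_def by (intro subspace_closure_complex complex_vector.subspace_span)
  have "(A ^^ k) g \<in> krylov A g" for k
    unfolding krylov_def by (rule complex_vector.span_base) blast
  then have pow_in_V: "(A ^^ k) g \<in> ?V" for k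
    by (rule subsetD[OF closure_subset])
  have R_pow: "?R ((A ^^ k) g) \<in> ?V" for k
  proof (induction k)
    case 0
    show ?case using Rg by simp
  next
    case (Suc k)
    let ?x = "(A ^^ k) g"
    have "?R (A ?x - \<zeta> *\<^sub>C ?x) = ?x"
      by (rule resolvent_left_inverse[OF \<zeta> funpow_smooth_vector_in_domain[OF g]])
    then have "?R (A ?x) = ?x + \<zeta> *\<^sub>C ?R ?x"
      by (simp add: R.diff resolvent_scaleC[OF lin \<zeta>] algebra_simps)
    then show ?case
      using V pow_in_V Suc
      by (simp add: complex_vector.subspace_add complex_vector.subspace_scale)
  qed
  have "complex_vector.subspace (?R -` ?V)"
    using V by (auto simp: complex_vector.subspace_def R.zero R.add resolvent_scaleC[OF lin \<zeta>])
  then have "krylov A g \<subseteq> ?R -` ?V"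
    unfolding krylov_def using R_pow[unfolded krylov_def]
    by (intro complex_vector.span_minimal) auto
  then show ?thesis
    by (intro image_closure_subset R.continuous_on[OF continuous_on_id]) auto
qed

text \<open>
  For \<open>v \<in> V\<close> the map \<open>x \<mapsto> R(\<zeta>) (v + (\<eta> - \<zeta>) x)\<close> is a contraction of the whole space and
  maps \<open>V\<close> into itself. Its fixed point in the whole space is \<open>R(\<eta>) v\<close>, and by uniqueness this is the fixed point that
  Banach's theorem provides inside \<open>V\<close>.
\<close>

lemma resolvent_invariance_transfer:
  fixes D :: "'a::complex_banach set"
  assumes V: "complex_vector.subspace V" "closed V"
    and \<zeta>: "\<zeta> \<in> resolvent_set D A" and \<eta>: "\<eta> \<in> resolvent_set D A"
    and M: "\<And>x. norm (resolvent D A \<zeta> x) \<le> M * norm x" "0 \<le> M"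
    and close: "cmod (\<eta> - \<zeta>) * M < 1"
    and inv: "resolvent D A \<zeta> ` V \<subseteq> V"
  shows "resolvent D A \<eta> ` V \<subseteq> V"
proof
  fix y assume "y \<in> resolvent D A \<eta> ` V"
  then obtain v where v: "v \<in> V" and y: "y = resolvent D A \<eta> v" by blast
  interpret R: bounded_linear "resolvent D A \<zeta>"
    by (rule resolvent_bounded_linear[OF \<zeta>])
  define f where "f x = resolvent D A \<zeta> (v + (\<eta> - \<zeta>) *\<^sub>C x)" for x
  define q where "q = cmod (\<eta> - \<zeta>) * M"
  have q: "0 \<le> q" "q < 1"
    using M(2) close by (auto simp: q_def)
  have contr: "dist (f x) (f x') \<le> q * dist x x'" for x x'
  proof -
    have "f x - f x' = resolvent D A \<zeta> ((\<eta> - \<zeta>) *\<^sub>C (x - x'))"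
      by (simp add: f_def complex_vector.scale_right_diff_distrib flip: R.diff)
    then have "norm (f x - f x') \<le> M * norm ((\<eta> - \<zeta>) *\<^sub>C (x - x'))"
      using M(1) by simp
    then show ?thesis
      by (simp add: dist_norm q_def norm_scaleC mult_ac)
  qed
  have fV: "f ` V \<subseteq> V"
    using inv v V(1) unfolding f_def
    by (auto simp: complex_vector.subspace_add complex_vector.subspace_scale)
  have "V \<noteq> {}" using v by blast
  then have "\<exists>!x\<in>V. f x = x"
    using Banach_fix[of V q f] V(2) q fV contr by (simp add: complete_eq_closed)
  then obtain x where x: "x \<in> V" "f x = x" by blast
  have "f y = y"
    unfolding f_def y by (rule resolvent_fixed_point[OF \<zeta> \<eta>])
  then have "dist x y \<le> q * dist x y"
    using contr[of x y] x(2) by simp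
  then have "dist x y = 0"
    using q(2) by (smt (verit) mult_less_cancel_right2 zero_le_dist)
  with x(1) show "y \<in> V" by simp
qed

lemma resolvent_norm_nearby:
  fixes D :: "'a::complex_normed_vector set"
  assumes \<zeta>: "\<zeta> \<in> resolvent_set D A" and \<eta>: "\<eta> \<in> resolvent_set D A"
    and M: "\<And>x. norm (resolvent D A \<zeta> x) \<le> M * norm x" "0 \<le> M"
    and close: "cmod (\<eta> - \<zeta>) * M \<le> 1 / 2"
  shows "norm (resolvent D A \<eta> v) \<le> 2 * M * norm v"
proof -
  define x where "x = resolvent D A \<eta> v"
  have "norm x = norm (resolvent D A \<zeta> (v + (\<eta> - \<zeta>) *\<^sub>C x))"
    unfolding x_def by (simp add: resolvent_fixed_point[OF \<zeta> \<eta>])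
  also have "\<dots> \<le> M * norm (v + (\<eta> - \<zeta>) *\<^sub>C x)"
    by (rule M(1))
  also have "\<dots> \<le> M * (norm v + cmod (\<eta> - \<zeta>) * norm x)"
    using norm_triangle_ineq[of v "(\<eta> - \<zeta>) *\<^sub>C x"] M(2)
    by (intro mult_left_mono) (simp_all add: norm_scaleC)
  also have "\<dots> = M * norm v + (cmod (\<eta> - \<zeta>) * M) * norm x"
    by (simp add: algebra_simps)
  also have "\<dots> \<le> M * norm v + (1 / 2) * norm x"
    using close by (intro add_left_mono mult_right_mono) auto
  finally show ?thesis
    by (simp add: x_def)
qed

text \<open>
  Passing from a nearby \<open>\<eta>\<close> back to \<open>\<zeta>\<close> uses a contraction built from \<open>R(\<eta>)\<close>, so its radius must
  not shrink as \<open>\<eta>\<close> varies. The uniform bound \<open>2 M\<close> for the norms of the nearby resolvents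
  provides this.
\<close>

lemma resolvent_invariance_locally_constant:
  fixes D :: "'a::complex_banach set"
  assumes V: "complex_vector.subspace V" "closed V"
    and \<zeta>: "\<zeta> \<in> resolvent_set D A"
  shows "\<exists>r>0. \<forall>\<eta> \<in> ball \<zeta> r \<inter> resolvent_set D A.
    resolvent D A \<eta> ` V \<subseteq> V \<longleftrightarrow> resolvent D A \<zeta> ` V \<subseteq> V"
proof -
  obtain M where M: "M > 0" "\<And>x. norm (resolvent D A \<zeta> x) \<le> M * norm x"
    using bounded_linear.pos_bounded[OF resolvent_bounded_linear[OF \<zeta>]]
    by (auto simp: mult.commute)
  \<comment> \<open>The radius has to satisfy \<open>r M \<le> 1/2\<close> for the norm bound and \<open>r (2 M) \<le> 1\<close> for the
    contraction built from \<open>R(\<eta>)\<close>; both say the same.\<close>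
  define r where "r = 1 / (2 * M)"
  have "resolvent D A \<eta> ` V \<subseteq> V \<longleftrightarrow> resolvent D A \<zeta> ` V \<subseteq> V"
    if "\<eta> \<in> ball \<zeta> r" and \<eta>: "\<eta> \<in> resolvent_set D A" for \<eta>
  proof -
    have close: "cmod (\<eta> - \<zeta>) * M < 1 / 2"
      using that(1) M(1) by (simp add: r_def dist_norm norm_minus_commute field_simps)
    have N: "norm (resolvent D A \<eta> x) \<le> 2 * M * norm x" for x
      using resolvent_norm_nearby[OF \<zeta> \<eta> M(2)] M(1) close by simp
    show ?thesis
    proof
      assume "resolvent D A \<eta> ` V \<subseteq> V"
      then show "resolvent D A \<zeta> ` V \<subseteq> V"
        using resolvent_invariance_transfer[OF V \<eta> \<zeta> N] M(1) close
        by (simp add: norm_minus_commute)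
    next
      assume "resolvent D A \<zeta> ` V \<subseteq> V"
      then show "resolvent D A \<eta> ` V \<subseteq> V"
        using resolvent_invariance_transfer[OF V \<zeta> \<eta> M(2)] M(1) close by simp
    qed
  qed
  moreover have "r > 0" using M(1) by (simp add: r_def)
  ultimately show ?thesis by blast
qed

theorem theorem3p5:
  fixes D :: "'a::complex_banach set" and A :: "'a \<Rightarrow> 'a" and g :: 'a and \<zeta>\<^sub>0 :: complex
  assumes "closed_linear_operator D A"
    and "g \<in> smooth_vectors D A"
    and "\<zeta>\<^sub>0 \<in> resolvent_set D A"
    and "resolvent D A \<zeta>\<^sub>0 g \<in> closure (krylov A g)"
    and "A ` (closure (krylov A g) \<inter> D) \<subseteq> closure (krylov A g)"
  shows "\<forall>\<zeta> \<in> connected_component_set (resolvent_set D A) \<zeta>\<^sub>0.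
    resolvent D A \<zeta> g \<in> closure (krylov A g)"
proof
  let ?V = "closure (krylov A g)"
    and ?C = "connected_component_set (resolvent_set D A) \<zeta>\<^sub>0"
  fix \<zeta> assume \<zeta>: "\<zeta> \<in> ?C"
  have V: "complex_vector.subspace ?V" "closed ?V"
    unfolding krylov_def
    by (auto intro: subspace_closure_complex complex_vector.subspace_span)
  have C_sub: "?C \<subseteq> resolvent_set D A"
    by (rule connected_component_subset)
  have start: "resolvent D A \<zeta>\<^sub>0 ` ?V \<subseteq> ?V"
    using assms by (intro resolvent_maps_krylov_closure) (auto simp: closed_linear_operator_def)
  define P where "P z \<longleftrightarrow> resolvent D A z ` ?V \<subseteq> ?V" for z
  have "P \<zeta>"
  proof (rule connected_induction_simple[where S = ?C and a = "\<zeta>\<^sub>0" and P = P])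
    fix z assume z: "z \<in> ?C"
    then have "z \<in> resolvent_set D A"
      using C_sub by (rule rev_subsetD)
    then obtain r where r: "r > 0"
      "\<forall>\<eta> \<in> ball z r \<inter> resolvent_set D A. P \<eta> \<longleftrightarrow> P z"
      using resolvent_invariance_locally_constant[OF V] unfolding P_def by blast
    have "openin (top_of_set ?C) (?C \<inter> ball z r)"
      by (rule openin_open_Int[OF open_ball])
    moreover have "z \<in> ?C \<inter> ball z r"
      using z r(1) by (intro IntI) simp_all
    moreover have "\<forall>x \<in> ?C \<inter> ball z r. \<forall>y \<in> ?C \<inter> ball z r. P x \<longrightarrow> P y"
      using r(2) C_sub by blast
    ultimately show "\<exists>T. openin (top_of_set ?C) T \<and> z \<in> T \<and> (\<forall>x\<in>T. \<forall>y\<in>T. P x \<longrightarrow> P y)"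
      by blast
  next
    show "\<zeta>\<^sub>0 \<in> ?C"
      using assms(3) by simp
    show "P \<zeta>\<^sub>0"
      using start by (simp add: P_def)
  qed (simp_all only: connected_connected_component \<zeta>)
  have "(A ^^ 0) g \<in> krylov A g"
    unfolding krylov_def by (rule complex_vector.span_base) blast
  then have "g \<in> ?V"
    using subsetD[OF closure_subset] by simp
  with \<open>P \<zeta>\<close> show "resolvent D A \<zeta> g \<in> ?V"
    by (simp add: P_def image_subset_iff)
qed

end
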